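(* Let $T_n$ denote the first time at which, with perfect play, Maker is guaranteed to have fully claimed a winning set in the Maker-Breaker $(n,\iota)$ game on $\mathbb{Z}^2$. Then, as $n \to \infty$, $$T_n \geq (1-o(1))\,n,$$ that is, for every $\varepsilon > 0$ there exists $N$ such that $T_n \geq (1-\varepsilon)n$ for all integers $n \geq N$.
   Context: The Maker-Breaker $(n,\iota)$ game, for a positive integer $n$, is played on the board $\mathbb{Z}^2$. The winning sets are all sets of $n$ consecutive points in a line, horizontally, vertically or diagonally, i.e. all sets $\{v + i d : 0 \leq i \leq n-1\}$ with $v \in \mathbb{Z}^2$ and $d \in \{(1,0),(0,1),(1,1),(1,-1)\}$. Turns are numbered (timed) $t = 1, 2, 3, \ldots$. Maker moves at odd times and Breaker at even times, and at time $t$ the player to move claims exactly $t$ points of the board, none of which has previously been claimed by either player. Both players have complete information about all previous moves. Maker wins if he claims all points of some winning set. Given a strategy $\Phi$ for Breaker and a strategy $\Psi$ for Maker, let $T(\Phi,\Psi)_n$ be the first time $t$ such that, when Breaker plays according to $\Phi$ and Maker according to $\Psi$, Maker has claimed all points of some winning set after the turn at time $t$ (with $T(\Phi,\Psi)_n = \infty$ if this never happens). Define $T_n = \max_{\Phi} \min_{\Psi} T(\Phi,\Psi)_n$, where $\Phi$ ranges over Breaker's strategies and $\Psi$ over Maker's strategies. *)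

theory Defs
  imports Complex_Main "HOL-Library.Extended_Nat" "HOL-Library.Extended_Real"
begin

type_synonym point = "int \<times> int"

definition winning_sets :: "nat \<Rightarrow> point set set" where
  "winning_sets n =
     {(\<lambda>i::nat. (x + int i * a, y + int i * b)) ` {..<n} | x y a b.
        (a, b) \<in> {(1, 0), (0, 1), (1, 1), (1, -1)}}"

text \<open>A history is the list of all moves made so far, by both players: the entry with index \<open>i\<close>
  is the set of points claimed at time \<open>i + 1\<close>. Hence Maker (odd times) is to move if the length
  of the history is even, and the entries with even index are his.\<close>

type_synonym history = "point set list"
type_synonym strategy = "history \<Rightarrow> point set"

text \<open>As the prescribed cardinality is positive, every legal move is a finite set.\<close>

definition legal_move :: "history \<Rightarrow> point set \<Rightarrow> bool" where
  "legal_move h m \<longleftrightarrow> card m = length h + 1 \<and> m \<inter> \<Union>(set h) = {}"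

definition legal_history :: "history \<Rightarrow> bool" where
  "legal_history h \<longleftrightarrow> (\<forall>i<length h. legal_move (take i h) (h ! i))"

definition maker_strategies :: "strategy set" where
  "maker_strategies = {\<Psi>. \<forall>h. legal_history h \<and> even (length h) \<longrightarrow> legal_move h (\<Psi> h)}"

definition breaker_strategies :: "strategy set" where
  "breaker_strategies = {\<Phi>. \<forall>h. legal_history h \<and> odd (length h) \<longrightarrow> legal_move h (\<Phi> h)}"

text \<open>\<open>play \<Phi> \<Psi> t\<close> is the history after the turn at time \<open>t\<close>, where Breaker
  follows \<open>\<Phi>\<close> and Maker follows \<open>\<Psi>\<close>.\<close>

primrec play :: "strategy \<Rightarrow> strategy \<Rightarrow> nat \<Rightarrow> history" where
  "play \<Phi> \<Psi> 0 = []"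
| "play \<Phi> \<Psi> (Suc t) =
     play \<Phi> \<Psi> t @ [if odd (Suc t) then \<Psi> (play \<Phi> \<Psi> t) else \<Phi> (play \<Phi> \<Psi> t)]"

definition maker_claimed :: "history \<Rightarrow> point set" where
  "maker_claimed h = (\<Union>i\<in>{i. i < length h \<and> even i}. h ! i)"

text \<open>In \<^typ>\<open>enat\<close> the infimum of the empty set is \<open>\<infinity>\<close>, and the infimum of a nonempty set
  is its least element.\<close>

definition win_time :: "nat \<Rightarrow> strategy \<Rightarrow> strategy \<Rightarrow> enat" where
  "win_time n \<Phi> \<Psi> =
     Inf (enat ` {t. 1 \<le> t \<and> (\<exists>W\<in>winning_sets n. W \<subseteq> maker_claimed (play \<Phi> \<Psi> t))})"

definition game_time :: "nat \<Rightarrow> enat" where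
  "game_time n = (SUP \<Phi>\<in>breaker_strategies. INF \<Psi>\<in>maker_strategies. win_time n \<Phi> \<Psi>)"

end

theory Submission
  imports Defs "HOL-Real_Asymp.Real_Asymp"
begin

text \<open>Fix \<open>q \<approx> \<epsilon> n / 2\<close> and let the boxes be the segments of length \<open>n - q\<close> whose starting
  coordinate is a multiple of \<open>q\<close>. Every winning set contains a box, and every point lies in at
  most \<open>c = 4 \<lfloor>n / q\<rfloor> = O(1 / \<epsilon>)\<close> boxes. Breaker plays the box game: at time \<open>t\<close> he hits the
  \<open>t\<close> boxes that contain the most Maker points among those he has not hit yet. The boxes he hits
  are at least as heavy as those he leaves, so comparing averages over a set of surviving boxes
  with averages over that set enlarged by the boxes just hit shows that after Breaker's move at
  time \<open>2 j\<close> any \<open>s\<close> surviving boxes contain on average at most \<open>c ln ((s + j (j + 1)) / s)\<close> Maker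
  points. Hence a surviving box contains \<open>O(log n)\<close> Maker points, and to complete it in one turn
  Maker needs \<open>t \<ge> n - q - O(log n)\<close>.\<close>

section \<open>Histories\<close>

definition breaker_claimed :: "history \<Rightarrow> point set" where
  "breaker_claimed h = (\<Union>i\<in>{i. i < length h \<and> odd i}. h ! i)"

lemma maker_claimed_Nil [simp]: "maker_claimed [] = {}"
  and breaker_claimed_Nil [simp]: "breaker_claimed [] = {}"
  by (simp_all add: maker_claimed_def breaker_claimed_def)

lemma maker_claimed_snoc:
  "maker_claimed (h @ [m]) = maker_claimed h \<union> (if even (length h) then m else {})"
  by (auto simp: maker_claimed_def nth_append less_Suc_eq split: if_splits)

lemma breaker_claimed_snoc:
  "breaker_claimed (h @ [m]) = breaker_claimed h \<union> (if odd (length h) then m else {})"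
  by (auto simp: breaker_claimed_def nth_append less_Suc_eq split: if_splits)

lemma Union_set_history: "\<Union>(set h) = maker_claimed h \<union> breaker_claimed h"
  by (induction h rule: rev_induct) (auto simp: maker_claimed_snoc breaker_claimed_snoc)

lemma legal_history_snoc:
  "legal_history (h @ [m]) \<longleftrightarrow> legal_history h \<and> legal_move h m"
  by (auto simp: legal_history_def less_Suc_eq nth_append)

lemma finite_legal_move: "legal_move h m \<Longrightarrow> finite m"
  by (auto simp: legal_move_def intro: card_ge_0_finite)

lemma finite_Union_legal_history: "legal_history h \<Longrightarrow> finite (\<Union>(set h))"
  by (induction h rule: rev_induct) (auto simp: legal_history_snoc finite_legal_move)

lemma maker_breaker_disjoint: "legal_history h \<Longrightarrow> maker_claimed h \<inter> breaker_claimed h = {}"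
  by (induction h rule: rev_induct)
    (auto simp: legal_history_snoc maker_claimed_snoc breaker_claimed_snoc legal_move_def
      Union_set_history)

lemma length_play [simp]: "length (play \<Phi> \<Psi> t) = t"
  by (induction t) auto

lemma legal_history_play:
  assumes "\<Phi> \<in> breaker_strategies" "\<Psi> \<in> maker_strategies"
  shows "legal_history (play \<Phi> \<Psi> t)"
proof (induction t)
  case 0
  show ?case by (simp add: legal_history_def)
next
  case (Suc t)
  then show ?case
    using assms by (auto simp: legal_history_snoc breaker_strategies_def maker_strategies_def)
qed

text \<open>Breaker's turns leave Maker's set unchanged, so a win only has to be excluded right
  after a Maker turn, at time \<open>t\<close> or \<open>t - 1\<close>.\<close>

lemma maker_claimed_play_odd:
  assumes "t \<ge> 1"
  obtains j where "2 * j + 1 \<le> t" "maker_claimed (play \<Phi> \<Psi> t) = maker_claimed (play \<Phi> \<Psi> (2 * j + 1))"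
proof (cases "odd t")
  case True
  then show ?thesis using that by (metis oddE order_refl)
next
  case False
  then obtain i where "t = 2 * i" by (meson evenE)
  with assms obtain j where j: "t = Suc (2 * j + 1)" by (cases i) auto
  have "maker_claimed (play \<Phi> \<Psi> t) = maker_claimed (play \<Phi> \<Psi> (2 * j + 1))"
    unfolding j by (subst play.simps(2)) (simp add: maker_claimed_snoc del: play.simps)
  moreover have "2 * j + 1 \<le> t" using j by simp
  ultimately show ?thesis using that by blast
qed

section \<open>The box game\<close>

text \<open>\<open>A\<close> may be infinite; the uniform bound \<open>b\<close> is what makes a
  maximum of \<open>f\<close> on the remaining elements exist. The set \<open>K\<close> grows by one
  such maximum at a time, until \<open>A\<close> is exhausted.\<close>

lemma exists_top_subset:
  fixes f :: "'a \<Rightarrow> nat"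
  assumes "\<And>x. x \<in> A \<Longrightarrow> f x \<le> b"
  shows "\<exists>K\<subseteq>A. finite K \<and> card K \<le> k \<and> (card K = k \<or> K = A) \<and> (\<forall>x\<in>K. \<forall>y\<in>A - K. f y \<le> f x)"
proof (induction k)
  case 0
  show ?case by (intro exI[of _ "{}"]) auto
next
  case (Suc k)
  then obtain K where K: "K \<subseteq> A" "finite K" "card K \<le> k" "card K = k \<or> K = A"
    "\<forall>x\<in>K. \<forall>y\<in>A - K. f y \<le> f x" by blast
  show ?case
  proof (cases "K = A")
    case True
    then show ?thesis using K by (intro exI[of _ K]) auto
  next
    case False
    then obtain a where "a \<in> A - K" using K by blast
    moreover have "\<forall>y. y \<in> A - K \<longrightarrow> f y < Suc b"
      using assms by (auto simp: less_Suc_eq_le)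
    ultimately obtain x where x: "x \<in> A - K" "\<And>y. y \<in> A - K \<Longrightarrow> f y \<le> f x"
      using ex_has_greatest_nat[of "\<lambda>x. x \<in> A - K" a f "Suc b"] by blast
    then show ?thesis
      using K False by (intro exI[of _ "insert x K"]) auto
  qed
qed

text \<open>This is \<open>ln u \<le> u - 1\<close> at \<open>u = s / (s + k)\<close>. It turns the
  gain per box in one round into a logarithm that telescopes over the rounds.\<close>

lemma ln_ratio_ge:
  fixes s k :: real
  assumes "s > 0" "k \<ge> 0"
  shows "k / (s + k) \<le> ln ((s + k) / s)"
proof -
  have "ln (s / (s + k)) \<le> s / (s + k) - 1"
    using assms by (intro ln_le_minus_one) auto
  moreover have "s / (s + k) - 1 = - (k / (s + k))"
    using assms by (simp add: field_simps)
  moreover have "ln ((s + k) / s) = - ln (s / (s + k))"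
    using assms by (simp add: ln_div)
  ultimately show ?thesis by linarith
qed

text \<open>Here \<open>X\<close> is the total weight of \<open>s\<close> surviving boxes,
  \<open>Y\<close> that of the \<open>k\<close> boxes just hit, and \<open>c * k\<close> bounds what
  Maker's last move added. By \<open>le\<close> the average over the survivors is at most the
  average over all \<open>s + k\<close> boxes; the extra \<open>k / (s + k)\<close> is absorbed by
  \<open>ln ((s + k) / s)\<close>, and the two logarithms add up.\<close>

lemma average_step:
  fixes s k X Y c r :: real
  assumes pos: "s > 0" "k \<ge> 0" "c \<ge> 0" "r \<ge> 0"
    and le: "k * X \<le> s * Y"
    and sum: "X + Y \<le> (s + k) * (c * ln ((s + k + r) / (s + k))) + c * k"
  shows "X \<le> s * (c * ln ((s + k + r) / s))"
proof -
  have "(s + k) * X \<le> s * (X + Y)"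
    using le by (simp add: algebra_simps)
  also have "\<dots> \<le> s * ((s + k) * (c * ln ((s + k + r) / (s + k))) + c * k)"
    using sum pos by (intro mult_left_mono) auto
  also have "\<dots> = (s + k) * (s * (c * (ln ((s + k + r) / (s + k)) + k / (s + k))))"
    using pos by (simp add: field_simps)
  finally have "X \<le> s * (c * (ln ((s + k + r) / (s + k)) + k / (s + k)))"
    using pos by (simp add: mult_le_cancel_left)
  also have "\<dots> \<le> s * (c * (ln ((s + k + r) / (s + k)) + ln ((s + k) / s)))"
    using pos ln_ratio_ge[of s k] by (intro mult_left_mono add_left_mono) auto
  also have "ln ((s + k + r) / (s + k)) + ln ((s + k) / s) = ln ((s + k + r) / s)"
    using pos by (simp add: ln_div)
  finally show ?thesis .
qed

text \<open>The family \<open>F\<close> may be infinite; only local finiteness is assumed. Since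
  \<open>card\<close> of an infinite set is 0, \<open>degree_le\<close> bounds the degree only
  together with \<open>finite_degree\<close>.\<close>

locale box_family =
  fixes F :: "point set set" and L c :: nat
  assumes finite_box: "B \<in> F \<Longrightarrow> finite B"
    and card_box: "B \<in> F \<Longrightarrow> card B = L"
    and finite_degree: "finite {B \<in> F. p \<in> B}"
    and degree_le: "card {B \<in> F. p \<in> B} \<le> c"
begin

section \<open>Breaker's greedy move\<close>

definition alive :: "history \<Rightarrow> point set set" where
  "alive h = {B \<in> F. B \<inter> breaker_claimed h = {}}"

definition weight :: "history \<Rightarrow> point set \<Rightarrow> nat" where
  "weight h B = card (B \<inter> maker_claimed h)"

text \<open>\<open>K\<close> collects the heaviest alive boxes, or all of them if there are too few.
  A box without free points cannot be hit, so it is exempted; this way a greedy move exists after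
  every legal history.\<close>

definition greedy_move :: "history \<Rightarrow> point set \<Rightarrow> bool" where
  "greedy_move h m \<longleftrightarrow> legal_move h m \<and>
     (\<exists>K\<subseteq>alive h. finite K \<and> (card K = length h + 1 \<or> K = alive h) \<and>
        (\<forall>B\<in>K. \<forall>B'\<in>alive h - K. weight h B' \<le> weight h B) \<and>
        (\<forall>B\<in>K. B \<subseteq> \<Union>(set h) \<or> B \<inter> m \<noteq> {}))"

text \<open>One free point is chosen in each box of \<open>K\<close> that still has one. These may
  be fewer than \<open>length h + 1\<close> points, because boxes can share a point or be too few,
  so the move is padded with arbitrary fresh points \<open>R\<close>.\<close>

lemma exists_greedy_move:
  assumes "legal_history h"
  shows "\<exists>m. greedy_move h m"
proof -
  have le: "weight h B \<le> L" if "B \<in> alive h" for B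
    using that finite_box[of B] card_box[of B] card_mono[of B "B \<inter> maker_claimed h"]
    by (simp add: alive_def weight_def)
  obtain K where K: "K \<subseteq> alive h" "finite K" "card K \<le> length h + 1"
    "card K = length h + 1 \<or> K = alive h"
    "\<forall>B\<in>K. \<forall>B'\<in>alive h - K. weight h B' \<le> weight h B"
    using exists_top_subset[of "alive h" "weight h" L "length h + 1"] le
    by (elim exE conjE meta_impE) auto
  define K' where "K' = {B \<in> K. \<not> B \<subseteq> \<Union>(set h)}"
  have "\<forall>B\<in>K'. \<exists>p. p \<in> B - \<Union>(set h)" by (auto simp: K'_def)
  then obtain g where g: "\<And>B. B \<in> K' \<Longrightarrow> g B \<in> B - \<Union>(set h)" by metis
  have K': "finite K'" "card K' \<le> length h + 1"
    using K card_mono[of K K'] by (auto simp: K'_def)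
  have card_g: "card (g ` K') \<le> length h + 1"
    using card_image_le[OF K'(1)] K'(2) le_trans by blast
  have "infinite (UNIV - (\<Union>(set h) \<union> g ` K') :: point set)"
    using finite_Union_legal_history[OF assms] K'(1)
    by (intro Diff_infinite_finite) (auto simp: finite_prod)
  then obtain R where R: "R \<subseteq> UNIV - (\<Union>(set h) \<union> g ` K')" "finite R"
    "card R = length h + 1 - card (g ` K')"
    using infinite_arbitrarily_large by metis
  have "card (g ` K' \<union> R) = length h + 1"
    using R K' card_g by (subst card_Un_disjoint) auto
  then have "legal_move h (g ` K' \<union> R)"
    using g R by (auto simp: legal_move_def)
  moreover have "\<forall>B\<in>K. B \<subseteq> \<Union>(set h) \<or> B \<inter> (g ` K' \<union> R) \<noteq> {}"
    using g unfolding K'_def by blast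
  ultimately show ?thesis
    unfolding greedy_move_def using K by blast
qed

definition greedy_strategy :: strategy where
  "greedy_strategy h = (SOME m. greedy_move h m)"

lemma greedy_strategy: "legal_history h \<Longrightarrow> greedy_move h (greedy_strategy h)"
  unfolding greedy_strategy_def using exists_greedy_move by (rule someI_ex)

lemma greedy_strategy_legal: "greedy_strategy \<in> breaker_strategies"
  using greedy_strategy by (auto simp: breaker_strategies_def greedy_move_def)

section \<open>Growth of weights and the invariant on averages\<close>

lemma sum_card_inter_le:
  assumes "finite T" "T \<subseteq> F" "finite m"
  shows "(\<Sum>B\<in>T. card (B \<inter> m)) \<le> c * card m"
proof -
  \<comment> \<open>Incidences between the boxes of \<open>T\<close> and the points of
    \<open>m\<close> are counted in two ways.\<close>
  have "(\<Sum>B\<in>T. card (B \<inter> m)) = (\<Sum>B\<in>T. \<Sum>p\<in>m. if p \<in> B then 1 else 0)"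
    using assms by (intro sum.cong) (auto simp: sum.If_cases Int_commute)
  also have "\<dots> = (\<Sum>p\<in>m. \<Sum>B\<in>T. if p \<in> B then 1 else 0)"
    by (rule sum.swap)
  also have "\<dots> = (\<Sum>p\<in>m. card {B \<in> T. p \<in> B})"
    using assms by (intro sum.cong) (auto simp: sum.If_cases Int_def)
  also have "\<dots> \<le> (\<Sum>p\<in>m. c)"
  proof (rule sum_mono)
    fix p
    have "card {B \<in> T. p \<in> B} \<le> card {B \<in> F. p \<in> B}"
      using assms finite_degree by (intro card_mono) auto
    then show "card {B \<in> T. p \<in> B} \<le> c" using degree_le le_trans by blast
  qed
  finally show ?thesis by (simp add: mult.commute)
qed

lemma weight_snoc_le: "weight (h @ [m]) B \<le> weight h B + card (B \<inter> m)"
  unfolding weight_def maker_claimed_snoc by (auto simp: Int_Un_distrib card_Un_le)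

lemma weight_maker_move_le:
  assumes "legal_move h m"
  shows "weight (h @ [m]) B \<le> weight h B + (length h + 1)"
proof -
  have "card (B \<inter> m) \<le> length h + 1"
    using assms card_mono[of m "B \<inter> m"] finite_legal_move by (auto simp: legal_move_def)
  then show ?thesis using weight_snoc_le[of h m B] by linarith
qed

text \<open>The invariant after \<open>j\<close> full rounds. The number
  \<open>j * (j + 1) = 2 + 4 + ... + 2 * j\<close> is the total size of Breaker's first
  \<open>j\<close> moves. It is stated for all finite sets of alive boxes, since the induction
  enlarges \<open>S\<close> by the boxes hit next.\<close>

definition balanced :: "nat \<Rightarrow> history \<Rightarrow> bool" where
  "balanced j h \<longleftrightarrow> (\<forall>S\<subseteq>alive h. finite S \<and> S \<noteq> {} \<longrightarrow>
     real (\<Sum>B\<in>S. weight h B) \<le>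
       real (card S) * (real c * ln ((real (card S) + real (j * (j + 1))) / real (card S))))"

lemma balanced_weight_le:
  assumes "balanced j h" "B \<in> alive h"
  shows "real (weight h B) \<le> real c * ln (1 + real (j * (j + 1)))"
  using assms(1)[unfolded balanced_def, rule_format, of "{B}"] assms(2) by simp

text \<open>The old invariant is applied to \<open>S \<union> K\<close>, where \<open>K\<close>
  consists of the \<open>2 * j + 2\<close> boxes that Breaker has just hit, and
  \<open>average_step\<close> passes from \<open>S \<union> K\<close> to \<open>S\<close>. The
  assumption \<open>small\<close> says that Maker's move cannot complete an alive box.\<close>

lemma balanced_step:
  assumes bal: "balanced j h" and len: "length h = 2 * j"
    and maker: "legal_move h m" and greedy: "greedy_move (h @ [m]) m'"
    and small: "real c * ln (1 + real (j * (j + 1))) + real (2 * j + 1) < real L"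
  shows "balanced (Suc j) (h @ [m] @ [m'])"
  unfolding balanced_def
proof (intro allI impI, elim conjE)
  let ?h1 = "h @ [m]" and ?h2 = "h @ [m] @ [m']"
  fix S assume S: "S \<subseteq> alive ?h2" "finite S" "S \<noteq> {}"
  have alive1: "alive ?h1 = alive h"
    by (simp add: alive_def breaker_claimed_snoc len)
  have alive2: "alive ?h2 = {B \<in> alive h. B \<inter> m' = {}}"
    using breaker_claimed_snoc[of ?h1 m'] len by (auto simp: alive_def breaker_claimed_snoc)
  have weight2: "weight ?h2 B = weight ?h1 B" for B
    using maker_claimed_snoc[of ?h1 m'] len by (simp add: weight_def)
  have len1: "length ?h1 + 1 = 2 * j + 2" by (simp add: len)
  obtain K where K: "K \<subseteq> alive h" "finite K" "card K = 2 * j + 2 \<or> K = alive h"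
    "\<forall>B\<in>K. \<forall>B'\<in>alive h - K. weight ?h1 B' \<le> weight ?h1 B"
    "\<forall>B\<in>K. B \<subseteq> \<Union>(set ?h1) \<or> B \<inter> m' \<noteq> {}"
    using greedy unfolding greedy_move_def alive1 len1 by (elim exE conjE) (rule that)
  \<comment> \<open>An alive box without free points would belong entirely to Maker and have weight
    \<open>L\<close>, which \<open>small\<close> rules out. So the exemption in
    \<open>greedy_move\<close> never applies here.\<close>
  have hit: "B \<inter> m' \<noteq> {}" if B: "B \<in> K" for B
  proof -
    have "B \<in> alive h" using B K by blast
    have "\<not> B \<subseteq> \<Union>(set ?h1)"
    proof
      assume "B \<subseteq> \<Union>(set ?h1)"
      then have "B \<inter> maker_claimed ?h1 = B"
        using \<open>B \<in> alive h\<close> alive1 unfolding Union_set_history alive_def by blast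
      then have "weight ?h1 B = L"
        using \<open>B \<in> alive h\<close> card_box by (simp add: weight_def alive_def)
      with weight_maker_move_le[OF maker, of B] balanced_weight_le[OF bal \<open>B \<in> alive h\<close>] small
      show False by (simp add: len)
    qed
    then show ?thesis using K(5) B by blast
  qed
  have S_alive: "S \<subseteq> alive h" and disj: "S \<inter> K = {}"
    using S(1) hit unfolding alive2 by blast+
  \<comment> \<open>If \<open>K\<close> were all of \<open>alive h\<close>, no box would survive and
    \<open>S\<close> would be empty.\<close>
  then have card_K: "card K = 2 * j + 2" using K(3) S(3) by blast
  have T: "S \<union> K \<subseteq> alive h" "finite (S \<union> K)" "S \<union> K \<noteq> {}" "S \<union> K \<subseteq> F"
    using S_alive K S by (auto simp: alive_def)
  have card_T: "card (S \<union> K) = card S + (2 * j + 2)"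
    using S K disj card_K by (simp add: card_Un_disjoint)
  define X where "X = (\<Sum>B\<in>S. weight ?h1 B)"
  define Y where "Y = (\<Sum>B\<in>K. weight ?h1 B)"
  \<comment> \<open>Every box of \<open>K\<close> is at least as heavy as every box of
    \<open>S\<close>; summing over all pairs compares the two averages.\<close>
  have "card K * X = (\<Sum>B\<in>K. \<Sum>B'\<in>S. weight ?h1 B')"
    by (simp add: X_def)
  also have "\<dots> \<le> (\<Sum>B\<in>K. \<Sum>B'\<in>S. weight ?h1 B)"
    using K(4) S_alive disj by (intro sum_mono) blast
  also have "\<dots> = card S * Y"
    by (simp add: Y_def sum_distrib_left)
  finally have "real (card K * X) \<le> real (card S * Y)"
    by (simp only: of_nat_le_iff)
  then have le: "real (2 * j + 2) * real X \<le> real (card S) * real Y"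
    by (simp only: card_K of_nat_mult)
  have "X + Y = (\<Sum>B\<in>S \<union> K. weight ?h1 B)"
    using S K disj by (simp add: X_def Y_def sum.union_disjoint)
  also have "\<dots> \<le> (\<Sum>B\<in>S \<union> K. weight h B + card (B \<inter> m))"
    by (intro sum_mono weight_snoc_le)
  also have "\<dots> = (\<Sum>B\<in>S \<union> K. weight h B) + (\<Sum>B\<in>S \<union> K. card (B \<inter> m))"
    by (rule sum.distrib)
  also have "(\<Sum>B\<in>S \<union> K. card (B \<inter> m)) \<le> c * card m"
    using T finite_legal_move[OF maker] by (intro sum_card_inter_le)
  \<comment> \<open>Maker's \<open>2 * j + 1\<close> points are rounded up to
    \<open>2 * j + 2\<close>, the number of boxes hit, to fit \<open>average_step\<close>.\<close>
  also have "c * card m \<le> c * (2 * j + 2)"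
    using maker by (simp add: legal_move_def len)
  finally have "X + Y \<le> (\<Sum>B\<in>S \<union> K. weight h B) + c * (2 * j + 2)"
    by simp
  then have "real (X + Y) \<le> real ((\<Sum>B\<in>S \<union> K. weight h B) + c * (2 * j + 2))"
    by (simp only: of_nat_le_iff)
  then have "real X + real Y \<le> real (\<Sum>B\<in>S \<union> K. weight h B) + real c * real (2 * j + 2)"
    by (simp only: of_nat_add of_nat_mult)
  moreover have "real (\<Sum>B\<in>S \<union> K. weight h B) \<le> real (card (S \<union> K)) *
    (real c * ln ((real (card (S \<union> K)) + real (j * (j + 1))) / real (card (S \<union> K))))"
    using bal T unfolding balanced_def by blast
  ultimately have sum: "real X + real Y \<le> (real (card S) + real (2 * j + 2)) *
      (real c * ln ((real (card S) + real (2 * j + 2) + real (j * (j + 1))) /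
        (real (card S) + real (2 * j + 2)))) + real c * real (2 * j + 2)"
    unfolding card_T of_nat_add[of "card S"] by linarith
  have "real X \<le> real (card S) *
      (real c * ln ((real (card S) + real (2 * j + 2) + real (j * (j + 1))) / real (card S)))"
    using S by (intro average_step[OF _ _ _ _ le sum]) (auto simp: card_gt_0_iff)
  moreover have "real (card S) + real (2 * j + 2) + real (j * (j + 1)) =
      real (card S) + real (Suc j * (Suc j + 1))"
    by (simp add: algebra_simps)
  ultimately show "real (\<Sum>B\<in>S. weight ?h2 B) \<le> real (card S) *
      (real c * ln ((real (card S) + real (Suc j * (Suc j + 1))) / real (card S)))"
    unfolding weight2 X_def by (simp only:)
qed

section \<open>Greedy Breaker against a fixed Maker strategy up to time \<open>M\<close>\<close>

context
  fixes M :: nat and \<Psi> :: strategy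
  assumes horizon: "real M + real c * ln (1 + real M ^ 2) < real L"
    and maker: "\<Psi> \<in> maker_strategies"
begin

text \<open>The crude estimate \<open>j * (j + 1) \<le> (2 * j + 1)^2 \<le> M^2\<close> reduces the
  condition of every single round to \<open>horizon\<close>.\<close>

lemma budget_small:
  assumes "2 * j + 1 \<le> M"
  shows "real c * ln (1 + real (j * (j + 1))) + real (2 * j + 1) < real L"
proof -
  have "j * (j + 1) \<le> (2 * j + 1) * (2 * j + 1)" by (intro mult_mono) auto
  also have "\<dots> \<le> M * M" using assms by (intro mult_mono) auto
  finally have "real (j * (j + 1)) \<le> real M ^ 2"
    unfolding power2_eq_square of_nat_mult[symmetric] of_nat_le_iff .
  then have "ln (1 + real (j * (j + 1))) \<le> ln (1 + real M ^ 2)"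
    by (subst ln_le_cancel_iff) (auto intro: add_pos_nonneg)
  then have "real c * ln (1 + real (j * (j + 1))) \<le> real c * ln (1 + real M ^ 2)"
    by (intro mult_left_mono) auto
  then show ?thesis using horizon assms by linarith
qed

text \<open>For \<open>j > 0\<close> the bound \<open>2 * j \<le> M + 1\<close> says that the last
  Maker turn, at time \<open>2 * j - 1\<close>, is within the horizon, so that
  \<open>budget_small\<close> covers each round.\<close>

lemma balanced_play:
  assumes "2 * j \<le> M + 1"
  shows "balanced j (play greedy_strategy \<Psi> (2 * j))"
  using assms
proof (induction j)
  case 0
  show ?case by (auto simp: balanced_def weight_def)
next
  case (Suc j)
  let ?h = "play greedy_strategy \<Psi> (2 * j)"
  have legal: "legal_history (play greedy_strategy \<Psi> t)" for t
    using greedy_strategy_legal maker by (rule legal_history_play)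
  have "legal_move ?h (\<Psi> ?h)"
    using maker legal by (auto simp: maker_strategies_def)
  moreover have "greedy_move (?h @ [\<Psi> ?h]) (greedy_strategy (?h @ [\<Psi> ?h]))"
    using greedy_strategy[OF legal[of "Suc (2 * j)"]] by simp
  moreover have "real c * ln (1 + real (j * (j + 1))) + real (2 * j + 1) < real L"
    using Suc.prems by (intro budget_small) simp
  ultimately have "balanced (Suc j) (?h @ [\<Psi> ?h] @ [greedy_strategy (?h @ [\<Psi> ?h])])"
    using Suc by (intro balanced_step) auto
  then show ?case by simp
qed

text \<open>A box completed at the odd time \<open>2 * j + 1\<close> contains no Breaker point, so
  it was alive just before. Its weight was then at most logarithmic, and one move of
  \<open>2 * j + 1\<close> points cannot raise it to \<open>L\<close>.\<close>

lemma no_box_claimed: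
  assumes "1 \<le> t" "t \<le> M" "B \<in> F"
  shows "\<not> B \<subseteq> maker_claimed (play greedy_strategy \<Psi> t)"
proof
  assume sub: "B \<subseteq> maker_claimed (play greedy_strategy \<Psi> t)"
  obtain j where j: "2 * j + 1 \<le> t"
    "maker_claimed (play greedy_strategy \<Psi> t) = maker_claimed (play greedy_strategy \<Psi> (2 * j + 1))"
    using maker_claimed_play_odd[OF assms(1)] by metis
  let ?h = "play greedy_strategy \<Psi> (2 * j)"
  have legal: "legal_history (play greedy_strategy \<Psi> t)" for t
    using greedy_strategy_legal maker by (rule legal_history_play)
  have B: "B \<subseteq> maker_claimed (?h @ [\<Psi> ?h])"
    using sub j by simp
  have move: "legal_move ?h (\<Psi> ?h)"
    using maker legal by (auto simp: maker_strategies_def)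
  have "maker_claimed (?h @ [\<Psi> ?h]) \<inter> breaker_claimed (?h @ [\<Psi> ?h]) = {}"
    using maker_breaker_disjoint[OF legal[of "Suc (2 * j)"]] by simp
  then have alive: "B \<in> alive ?h"
    using B assms(3) unfolding alive_def breaker_claimed_snoc by blast
  have "weight (?h @ [\<Psi> ?h]) B = L"
    using B card_box[OF assms(3)] by (simp add: weight_def Int_absorb2)
  moreover have "real (weight ?h B) \<le> real c * ln (1 + real (j * (j + 1)))"
    using balanced_play[of j] j assms(2) alive by (intro balanced_weight_le) auto
  moreover have "real c * ln (1 + real (j * (j + 1))) + real (2 * j + 1) < real L"
    using j assms(2) by (intro budget_small) simp
  ultimately show False
    using weight_maker_move_le[OF move, of B] by simp
qed

end

text \<open>The greedy strategy alone bounds the supremum over Breaker's strategies from below,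
  because against every Maker strategy no win occurs up to time \<open>M\<close>.\<close>

lemma game_time_ge:
  assumes win: "\<And>W. W \<in> winning_sets n \<Longrightarrow> \<exists>B\<in>F. B \<subseteq> W"
    and horizon: "real M + real c * ln (1 + real M ^ 2) < real L"
  shows "enat M \<le> game_time n"
proof -
  have "enat M \<le> win_time n greedy_strategy \<Psi>" if "\<Psi> \<in> maker_strategies" for \<Psi>
    unfolding win_time_def
  proof (rule Inf_greatest)
    fix x assume "x \<in> enat ` {t. 1 \<le> t \<and>
      (\<exists>W\<in>winning_sets n. W \<subseteq> maker_claimed (play greedy_strategy \<Psi> t))}"
    then obtain t W where t: "x = enat t" "1 \<le> t" "W \<in> winning_sets n"
      "W \<subseteq> maker_claimed (play greedy_strategy \<Psi> t)" by blast
    then obtain B where "B \<in> F" "B \<subseteq> maker_claimed (play greedy_strategy \<Psi> t)"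
      using win by (meson order_trans)
    then have "\<not> t \<le> M"
      using no_box_claimed[OF horizon that] t(2) by blast
    then show "enat M \<le> x" by (simp add: t(1))
  qed
  then have "enat M \<le> (INF \<Psi>\<in>maker_strategies. win_time n greedy_strategy \<Psi>)"
    by (rule INF_greatest)
  also have "\<dots> \<le> game_time n"
    unfolding game_time_def by (rule SUP_upper[OF greedy_strategy_legal])
  finally show ?thesis .
qed

end

section \<open>Segments starting at multiples of \<open>q\<close>\<close>

definition directions :: "(int \<times> int) set" where
  "directions = {(1, 0), (0, 1), (1, 1), (1, -1)}"

definition segment :: "nat \<Rightarrow> int \<times> int \<Rightarrow> int \<times> int \<Rightarrow> point set" where
  "segment L v d = (\<lambda>i. (fst v + int i * fst d, snd v + int i * snd d)) ` {..<L}"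

text \<open>A coordinate that increases by \<open>1\<close> along direction \<open>d\<close>.\<close>

definition coord :: "int \<times> int \<Rightarrow> point \<Rightarrow> int" where
  "coord d v = (if fst d = 1 then fst v else snd v)"

text \<open>For \<open>q > 0\<close>, boxes start at every \<open>q\<close>-th point of each line in
  one of the four directions.\<close>

definition grid_segments :: "nat \<Rightarrow> nat \<Rightarrow> point set set" where
  "grid_segments q L = {segment L v d | v d. d \<in> directions \<and> int q dvd coord d v}"

lemma winning_sets_segment: "winning_sets n = {segment n v d | v d. d \<in> directions}"
  unfolding winning_sets_def segment_def directions_def split_paired_Ex fst_conv snd_conv by blast

lemma card_segment: "d \<in> directions \<Longrightarrow> card (segment L v d) = L"
  unfolding segment_def by (subst card_image) (auto simp: inj_on_def directions_def)

lemma coord_shift: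
  "d \<in> directions \<Longrightarrow> coord d (fst v + k * fst d, snd v + k * snd d) = coord d v + k"
  by (auto simp: directions_def coord_def)

lemma winning_set_contains_grid_segment:
  assumes "W \<in> winning_sets n" "0 < q" "q \<le> n"
  shows "\<exists>B\<in>grid_segments q (n - q). B \<subseteq> W"
proof -
  obtain v d where W: "W = segment n v d" "d \<in> directions"
    using assms(1) by (auto simp: winning_sets_segment)
  \<comment> \<open>The distance from the start of \<open>W\<close> to the next point whose
    coordinate is divisible by \<open>q\<close>. As \<open>k < q\<close>, the \<open>n - q\<close>
    points from there on stay inside \<open>W\<close>.\<close>
  define k where "k = nat ((- coord d v) mod int q)"
  have k: "int k = (- coord d v) mod int q" "k < q"
    using assms(2) by (auto simp: k_def nat_less_iff)
  define v' where "v' = (fst v + int k * fst d, snd v + int k * snd d)"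
  have "coord d v' = coord d v + (- coord d v) mod int q"
    unfolding v'_def using coord_shift[OF W(2)] k(1) by simp
  then have "int q dvd coord d v'"
    by (simp add: dvd_eq_mod_eq_0 mod_simps)
  then have "segment (n - q) v' d \<in> grid_segments q (n - q)"
    unfolding grid_segments_def using W(2) by blast
  moreover have "segment (n - q) v' d \<subseteq> W"
  proof
    fix p assume "p \<in> segment (n - q) v' d"
    then obtain i where "i < n - q" "p = (fst v' + int i * fst d, snd v' + int i * snd d)"
      by (auto simp: segment_def)
    then show "p \<in> W"
      unfolding W(1) segment_def using k(2)
      by (intro image_eqI[of _ _ "k + i"]) (auto simp: v'_def algebra_simps)
  qed
  ultimately show ?thesis by blast
qed

text \<open>The indices counted lie in one residue class modulo \<open>q\<close>, so each is
  determined by its quotient \<open>i div q\<close>, which is at most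
  \<open>L div q\<close>.\<close>

lemma card_arithmetic_progression_le:
  assumes "0 < q"
  shows "card {i. i < L \<and> int q dvd z - int i} \<le> L div q + 1"
proof -
  let ?A = "{i. i < L \<and> int q dvd z - int i}"
  have "inj_on (\<lambda>i. i div q) ?A"
  proof (rule inj_onI)
    fix i i' assume "i \<in> ?A" "i' \<in> ?A" and eq: "i div q = i' div q"
    then have "int q dvd (z - int i') - (z - int i)"
      unfolding mem_Collect_eq by (elim conjE) (rule dvd_diff)
    then have "int i mod int q = int i' mod int q" by (simp add: mod_eq_dvd_iff)
    then have "i mod q = i' mod q" by (simp flip: of_nat_mod)
    then show "i = i'" using eq by (metis div_mult_mod_eq)
  qed
  moreover have "(\<lambda>i. i div q) ` ?A \<subseteq> {..L div q}"
    by (auto intro: div_le_mono)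
  ultimately have "card ?A \<le> card {..L div q}"
    by (intro card_inj_on_le) auto
  then show ?thesis by simp
qed

text \<open>A box through \<open>p\<close> is determined by its direction \<open>d\<close> and the
  index \<open>i\<close> of \<open>p\<close> in it, and \<open>i\<close> must satisfy the
  divisibility condition of \<open>I d\<close>. The factor 4 counts directions.\<close>

lemma grid_segments_degree:
  assumes "0 < q"
  shows "finite {B \<in> grid_segments q L. p \<in> B}"
    and "card {B \<in> grid_segments q L. p \<in> B} \<le> 4 * (L div q + 1)"
proof -
  define I where "I d = {i. i < L \<and> int q dvd coord d p - int i}" for d
  define f where "f d i = segment L (fst p - int i * fst d, snd p - int i * snd d) d" for d i
  have sub: "{B \<in> grid_segments q L. p \<in> B} \<subseteq> (\<Union>d\<in>directions. f d ` I d)"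
  proof
    fix B assume "B \<in> {B \<in> grid_segments q L. p \<in> B}"
    then obtain v d where B: "B = segment L v d" "d \<in> directions" "int q dvd coord d v" "p \<in> B"
      by (auto simp: grid_segments_def)
    then obtain i where i: "i < L" "p = (fst v + int i * fst d, snd v + int i * snd d)"
      by (auto simp: segment_def)
    have "coord d p - int i = coord d v"
      unfolding i(2) by (simp add: coord_shift[OF B(2)])
    then have "i \<in> I d" using i(1) B(3) by (simp add: I_def)
    moreover have "B = f d i" by (simp add: f_def B(1) i(2))
    ultimately show "B \<in> (\<Union>d\<in>directions. f d ` I d)" using B(2) by blast
  qed
  have fin: "finite directions" "card directions = 4" by (auto simp: directions_def)
  have finU: "finite (\<Union>d\<in>directions. f d ` I d)"
    using fin by (auto simp: I_def)
  show "finite {B \<in> grid_segments q L. p \<in> B}"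
    using sub finU by (rule finite_subset)
  have "card {B \<in> grid_segments q L. p \<in> B} \<le> card (\<Union>d\<in>directions. f d ` I d)"
    using finU sub by (rule card_mono)
  also have "\<dots> \<le> (\<Sum>d\<in>directions. card (f d ` I d))"
    using fin(1) by (rule card_UN_le)
  also have "\<dots> \<le> (\<Sum>d\<in>directions. L div q + 1)"
  proof (rule sum_mono)
    fix d
    have "card (f d ` I d) \<le> card (I d)"
      by (rule card_image_le) (simp add: I_def)
    also have "\<dots> \<le> L div q + 1"
      unfolding I_def using assms by (rule card_arithmetic_progression_le)
    finally show "card (f d ` I d) \<le> L div q + 1" .
  qed
  finally show "card {B \<in> grid_segments q L. p \<in> B} \<le> 4 * (L div q + 1)"
    by (simp add: fin(2))
qed

lemma box_family_grid_segments:
  assumes "0 < q"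
  shows "box_family (grid_segments q L) L (4 * (L div q + 1))"
proof
  fix B assume "B \<in> grid_segments q L"
  then show "finite B" "card B = L"
    by (auto simp: grid_segments_def card_segment) (simp add: segment_def)
qed (use grid_segments_degree[OF assms] in auto)

section \<open>Choice of parameters and the asymptotic bound\<close>

theorem theorem2:
  shows "\<forall>\<epsilon>::real. \<epsilon> > 0 \<longrightarrow>
    (\<exists>N::nat. \<forall>n::nat. n \<ge> N \<longrightarrow>
      ereal_of_enat (game_time n) \<ge> ereal ((1 - \<epsilon>) * real n))"
proof (intro allI impI)
  fix \<epsilon> :: real assume "\<epsilon> > 0"
  show "\<exists>N::nat. \<forall>n::nat. n \<ge> N \<longrightarrow> ereal_of_enat (game_time n) \<ge> ereal ((1 - \<epsilon>) * real n)"
  proof (cases "\<epsilon> \<ge> 1")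
    case True
    have "ereal ((1 - \<epsilon>) * real n) \<le> ereal_of_enat (game_time n)" for n
    proof -
      have "ereal ((1 - \<epsilon>) * real n) \<le> 0"
        using True by (simp add: mult_nonpos_nonneg)
      also have "0 \<le> ereal_of_enat (game_time n)" by simp
      finally show ?thesis .
    qed
    then show ?thesis by blast
  next
    case False
    \<comment> \<open>\<open>8 / \<epsilon>\<close> will bound the degree \<open>c\<close>, and the
      right-hand side is a lower bound for \<open>n - q - M\<close>. The 2 pays for the two ceilings
      in \<open>q\<close> and \<open>M\<close>.\<close>
    have "\<forall>\<^sub>F n::nat in at_top. 8 / \<epsilon> * ln (1 + real n ^ 2) < \<epsilon> / 2 * real n - 2"
      using \<open>\<epsilon> > 0\<close> by real_asymp
    then obtain N where N:
      "\<And>n. n \<ge> N \<Longrightarrow> 8 / \<epsilon> * ln (1 + real n ^ 2) < \<epsilon> / 2 * real n - 2"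
      by (auto simp: eventually_at_top_linorder)
    show ?thesis
    proof (intro exI[of _ "max N 1"] allI impI)
      fix n assume n: "n \<ge> max N 1"
      define q where "q = nat \<lceil>\<epsilon> / 2 * real n\<rceil>"
      define M where "M = nat \<lceil>(1 - \<epsilon>) * real n\<rceil>"
      define c where "c = 4 * ((n - q) div q + 1)"
      have pos: "0 < \<epsilon> / 2 * real n" "0 \<le> (1 - \<epsilon>) * real n"
        using \<open>\<epsilon> > 0\<close> False n by auto
      have q: "\<epsilon> / 2 * real n \<le> real q" "real q < \<epsilon> / 2 * real n + 1"
        unfolding q_def using pos by linarith+
      have M: "(1 - \<epsilon>) * real n \<le> real M" "real M < (1 - \<epsilon>) * real n + 1"
        unfolding M_def using pos by linarith+
      have "\<epsilon> / 2 * real n \<le> 1 * real n" "(1 - \<epsilon>) * real n \<le> 1 * real n"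
        using \<open>\<epsilon> > 0\<close> False by (intro mult_right_mono; simp)+
      then have "q \<le> n" "M \<le> n"
        unfolding q_def M_def by (simp_all add: ceiling_le_iff nat_le_iff)
      have "0 < q" using q pos by linarith
      \<comment> \<open>Since \<open>q \<le> n\<close>,
        \<open>(n - q) div q + 1 = n div q\<close>.\<close>
      have "real c = 4 * real (n div q)"
        unfolding c_def using \<open>q \<le> n\<close> \<open>0 < q\<close> by (simp add: le_div_geq)
      also have "\<dots> \<le> 4 * (real n / real q)"
        using of_nat_div_le_of_nat by (intro mult_left_mono) auto
      also have "\<dots> \<le> 4 * (real n / (\<epsilon> / 2 * real n))"
        using q pos \<open>0 < q\<close> by (intro mult_left_mono divide_left_mono) auto
      also have "\<dots> = 8 / \<epsilon>" using n by simp
      finally have "real c \<le> 8 / \<epsilon>" .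
      moreover have "real M ^ 2 \<le> real n ^ 2" using \<open>M \<le> n\<close> by (intro power_mono) auto
      then have "ln (1 + real M ^ 2) \<le> ln (1 + real n ^ 2)"
        by (subst ln_le_cancel_iff) (auto intro: add_pos_nonneg)
      ultimately have "real c * ln (1 + real M ^ 2) \<le> 8 / \<epsilon> * ln (1 + real n ^ 2)"
        using \<open>\<epsilon> > 0\<close> by (intro mult_mono) auto
      also have "\<dots> < \<epsilon> / 2 * real n - 2" using N n by simp
      finally have "real M + real c * ln (1 + real M ^ 2) < real (n - q)"
        using M(2) q(2) \<open>q \<le> n\<close> by (simp add: algebra_simps of_nat_diff)
      then have "enat M \<le> game_time n"
        unfolding c_def using winning_set_contains_grid_segment \<open>0 < q\<close> \<open>q \<le> n\<close>
        by (intro box_family.game_time_ge[OF box_family_grid_segments[OF \<open>0 < q\<close>]])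
      then have "ereal_of_enat (enat M) \<le> ereal_of_enat (game_time n)"
        by (simp only: ereal_of_enat_le_iff)
      moreover have "ereal ((1 - \<epsilon>) * real n) \<le> ereal_of_enat (enat M)"
        using M(1) by simp
      ultimately show "ereal ((1 - \<epsilon>) * real n) \<le> ereal_of_enat (game_time n)"
        by (rule order_trans[rotated])
    qed
  qed
qed

end
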